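(* Let $I=\{1,\ldots,k\}$ and let $F=\{f_i\}_{i\in I}\subseteq\mathcal{H}^n\setminus\{0\}$ be a tight frame for $\mathcal{H}^n$ with factor poset $\mathbb{F}_F$. Let $C,D\in\mathbb{F}_F$. Then the following are equivalent: (i) $C\cup D\in\mathbb{F}_F$; (ii) $C\cap D\in\mathbb{F}_F$; (iii) $C\triangle D\in\mathbb{F}_F$, where $C\triangle D$ is the symmetric difference; (iv) $C\setminus D\in\mathbb{F}_F$.
   Context: $\mathcal{H}^n$ denotes $\mathbb{R}^n$ or $\mathbb{C}^n$. A finite sequence $\{f_i\}_{i\in I}$ of vectors (repetitions allowed) in $\mathcal{H}^n$ is a frame for $\mathcal{H}^n$ if there are constants $A,B>0$ with $A\|f\|^2\le\sum_{i\in I}|\langle f,f_i\rangle|^2\le B\|f\|^2$ for all $f\in\mathcal{H}^n$. It is a tight frame if one can take $A=B$. The factor poset $\mathbb{F}_F$ of a finite frame $F=\{f_i\}_{i\in I}$ of nonzero vectors is the collection of subsets of $I$, ordered by inclusion, such that $\emptyset\in\mathbb{F}_F$ and a non-empty $J\subseteq I$ belongs to $\mathbb{F}_F$ if and only if $\{f_j\}_{j\in J}$ is a tight frame for $\mathcal{H}^n$. *)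

theory Defs
  imports "HOL-Analysis.Analysis"
begin

text \<open>
  On \<^typ>\<open>complex ^ 'n\<close> the library's \<^const>\<open>inner\<close> is the real-valued inner product (the real part of
  the Hermitian one), so the Hermitian inner product is defined here.  Its norm is the library norm.
\<close>

definition hermitian :: "complex ^ 'n \<Rightarrow> complex ^ 'n \<Rightarrow> complex" where
  "hermitian x y = (\<Sum>i\<in>UNIV. x $ i * cnj (y $ i))"

lemma hermitian_self: "hermitian x x = complex_of_real ((norm x)\<^sup>2)"
  by (simp add: hermitian_def norm_vec_def L2_set_def sum_nonneg flip: complex_norm_square)

text \<open>
  The notions below take the inner product as a parameter \<open>ip\<close>, so that they apply to both real
  space (with \<^const>\<open>inner\<close>) and complex space (with \<^const>\<open>hermitian\<close>).
\<close>

definition frame_bounds ::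
  "('v::real_normed_vector \<Rightarrow> 'v \<Rightarrow> 's::real_normed_field) \<Rightarrow> ('i \<Rightarrow> 'v) \<Rightarrow> 'i set \<Rightarrow> real \<Rightarrow> real \<Rightarrow> bool"
  where
  "frame_bounds ip f J A B \<longleftrightarrow> finite J \<and> A > 0 \<and> B > 0 \<and>
     (\<forall>x. A * (norm x)\<^sup>2 \<le> (\<Sum>i\<in>J. (norm (ip x (f i)))\<^sup>2) \<and>
          (\<Sum>i\<in>J. (norm (ip x (f i)))\<^sup>2) \<le> B * (norm x)\<^sup>2)"

definition is_frame ::
  "('v::real_normed_vector \<Rightarrow> 'v \<Rightarrow> 's::real_normed_field) \<Rightarrow> ('i \<Rightarrow> 'v) \<Rightarrow> 'i set \<Rightarrow> bool" where
  "is_frame ip f J \<longleftrightarrow> (\<exists>A B. frame_bounds ip f J A B)"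

definition tight_frame ::
  "('v::real_normed_vector \<Rightarrow> 'v \<Rightarrow> 's::real_normed_field) \<Rightarrow> ('i \<Rightarrow> 'v) \<Rightarrow> 'i set \<Rightarrow> bool" where
  "tight_frame ip f J \<longleftrightarrow> is_frame ip f J \<and> (\<exists>A. frame_bounds ip f J A A)"

text \<open>The order on the factor poset is the subset relation \<open>(\<subseteq>)\<close> on its members.\<close>

definition factor_poset ::
  "('v::real_normed_vector \<Rightarrow> 'v \<Rightarrow> 's::real_normed_field) \<Rightarrow> ('i \<Rightarrow> 'v) \<Rightarrow> 'i set \<Rightarrow> 'i set set" where
  "factor_poset ip f I = {J. J \<subseteq> I \<and> (J = {} \<or> tight_frame ip f J)}"

end

theory Submission
  imports Defs
begin

text \<open>
  For subfamilies of a finite family of nonzero vectors, membership in the factor poset means that the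
  quadratic form of the frame operator is a scalar multiple of the squared norm; the empty family is
  covered by the scalar 0.  These forms are additive over disjoint unions, so those of the union,
  the symmetric difference and the difference of \<open>C\<close> and \<open>D\<close> are combinations of the forms of
  \<open>C\<close>, \<open>D\<close> and \<open>C \<inter> D\<close> in which that of \<open>C \<inter> D\<close> has a nonzero coefficient.
\<close>

definition frame_form ::
  "('v::real_normed_vector \<Rightarrow> 'v \<Rightarrow> 's::real_normed_field) \<Rightarrow> ('i \<Rightarrow> 'v) \<Rightarrow> 'i set \<Rightarrow> 'v \<Rightarrow> real" where
  "frame_form ip f J x = (\<Sum>i\<in>J. (norm (ip x (f i)))\<^sup>2)"

text \<open>The scalar may be any real, with no sign condition, so that these forms make up a vector
  space; the positivity that a frame bound requires is recovered separately for nonempty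
  families.\<close>

definition scalar_form :: "('v::real_normed_vector \<Rightarrow> real) \<Rightarrow> bool" where
  "scalar_form q \<longleftrightarrow> (\<exists>A. \<forall>x. q x = A * (norm x)\<^sup>2)"

lemma scalar_form_add:
  assumes "scalar_form p" "scalar_form q"
  shows "scalar_form (\<lambda>x. p x + q x)"
proof -
  obtain A B where "\<forall>x. p x = A * (norm x)\<^sup>2" "\<forall>x. q x = B * (norm x)\<^sup>2"
    using assms unfolding scalar_form_def by blast
  then have "\<forall>x. p x + q x = (A + B) * (norm x)\<^sup>2"
    by (simp add: distrib_right)
  then show ?thesis
    unfolding scalar_form_def by blast
qed

lemma scalar_form_scale:
  assumes "scalar_form q"
  shows "scalar_form (\<lambda>x. c * q x)"
proof -
  obtain B where "\<forall>x. q x = B * (norm x)\<^sup>2"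
    using assms unfolding scalar_form_def by blast
  then have "\<forall>x. c * q x = (c * B) * (norm x)\<^sup>2"
    by simp
  then show ?thesis
    unfolding scalar_form_def by blast
qed

lemma scalar_form_diff:
  assumes "scalar_form p" "scalar_form q"
  shows "scalar_form (\<lambda>x. p x - q x)"
  using scalar_form_add[OF assms(1) scalar_form_scale[OF assms(2), of "- 1"]] by simp

text \<open>Since \<open>c\<close> is invertible, \<open>q\<close> can be solved for within the
  vector space of scalar forms. Each equivalence with \<open>C \<inter> D\<close> below is an
  instance, with \<open>q\<close> the form of \<open>C \<inter> D\<close>.\<close>

lemma scalar_form_diff_scale_iff:
  assumes "scalar_form p" "c \<noteq> 0"
  shows "scalar_form (\<lambda>x. p x - c * q x) \<longleftrightarrow> scalar_form q"
proof
  assume "scalar_form (\<lambda>x. p x - c * q x)"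
  from scalar_form_scale[OF scalar_form_diff[OF assms(1) this], of "1 / c"]
  show "scalar_form q"
    using assms(2) by simp
next
  assume "scalar_form q"
  then show "scalar_form (\<lambda>x. p x - c * q x)"
    using assms(1) by (intro scalar_form_diff scalar_form_scale)
qed

text \<open>A tight frame has equal lower and upper bounds, which force equality. Conversely, the
  scalar of a nonempty subfamily is automatically positive, because its vectors are nonzero and
  \<open>ip\<close> does not vanish at \<open>(v, v)\<close> for nonzero \<open>v\<close>.\<close>

lemma factor_poset_iff_scalar_form:
  assumes "finite I" "\<forall>v. v \<noteq> 0 \<longrightarrow> ip v v \<noteq> 0" "\<forall>i\<in>I. f i \<noteq> 0" "J \<subseteq> I"
  shows "J \<in> factor_poset ip f I \<longleftrightarrow> scalar_form (frame_form ip f J)"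
proof
  assume "J \<in> factor_poset ip f I"
  then consider "J = {}" | "tight_frame ip f J"
    unfolding factor_poset_def by blast
  then show "scalar_form (frame_form ip f J)"
  proof cases
    case 1
    then show ?thesis
      by (auto simp: scalar_form_def frame_form_def intro: exI[of _ 0])
  next
    case 2
    then show ?thesis
      unfolding tight_frame_def frame_bounds_def scalar_form_def frame_form_def
      by (meson order_antisym)
  qed
next
  assume "scalar_form (frame_form ip f J)"
  then obtain A where A: "\<And>x. frame_form ip f J x = A * (norm x)\<^sup>2"
    unfolding scalar_form_def by blast
  have fin: "finite J"
    using assms(1,4) finite_subset by blast
  have "tight_frame ip f J" if "j \<in> J" for j
  proof -
    have nz: "f j \<noteq> 0"
      using that assms(3,4) by blast
    \<comment> \<open>Testing the form at the member \<open>f j\<close> itself: its own summand is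
      already positive, and the others are nonnegative.\<close>
    have "0 < (norm (ip (f j) (f j)))\<^sup>2"
      using assms(2) nz by simp
    also have "\<dots> \<le> frame_form ip f J (f j)"
      unfolding frame_form_def using fin that
      by (intro member_le_sum[of j J "\<lambda>i. (norm (ip (f j) (f i)))\<^sup>2"]) auto
    finally have "A > 0"
      unfolding A using nz by (simp add: zero_less_mult_iff)
    then have "frame_bounds ip f J A A"
      using fin A unfolding frame_bounds_def frame_form_def by simp
    then show ?thesis
      unfolding tight_frame_def is_frame_def by blast
  qed
  then show "J \<in> factor_poset ip f I"
    using assms(4) unfolding factor_poset_def by blast
qed

lemma frame_form_diff:
  assumes "finite C"
  shows "frame_form ip f (C - D) x = frame_form ip f C x - frame_form ip f (C \<inter> D) x"
  unfolding frame_form_def by (simp add: sum.Int_Diff[OF assms, of _ D])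

lemma frame_form_Un:
  assumes "finite C" "finite D"
  shows "frame_form ip f (C \<union> D) x =
    frame_form ip f C x + frame_form ip f D x - frame_form ip f (C \<inter> D) x"
  unfolding frame_form_def using assms by (simp add: sum_Un)

text \<open>Each of the disjoint pieces \<open>C - D\<close> and \<open>D - C\<close> loses one copy
  of the intersection, hence the coefficient 2.\<close>

lemma frame_form_sym_diff:
  assumes "finite C" "finite D"
  shows "frame_form ip f (sym_diff C D) x =
    frame_form ip f C x + frame_form ip f D x - 2 * frame_form ip f (C \<inter> D) x"
proof -
  have "(C - D) \<inter> (D - C) = {}"
    by blast
  \<comment> \<open>The second \<open>simp\<close> evaluates the form of the empty overlap to
    0.\<close>
  then have "frame_form ip f (sym_diff C D) x = frame_form ip f (C - D) x + frame_form ip f (D - C) x"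
    using assms by (simp add: frame_form_Un) (simp add: frame_form_def)
  then show ?thesis
    using assms by (simp add: frame_form_diff Int_commute)
qed

lemma factor_poset_Un_Int_sym_diff_Diff:
  assumes fin: "finite I" and ip: "\<forall>v. v \<noteq> 0 \<longrightarrow> ip v v \<noteq> 0" and nz: "\<forall>i\<in>I. f i \<noteq> 0"
    and C: "C \<in> factor_poset ip f I" and D: "D \<in> factor_poset ip f I"
  shows "C \<union> D \<in> factor_poset ip f I \<longleftrightarrow> C \<inter> D \<in> factor_poset ip f I"
    and "C \<inter> D \<in> factor_poset ip f I \<longleftrightarrow> sym_diff C D \<in> factor_poset ip f I"
    and "sym_diff C D \<in> factor_poset ip f I \<longleftrightarrow> C - D \<in> factor_poset ip f I"
proof -
  have sub: "C \<subseteq> I" "D \<subseteq> I"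
    using C D unfolding factor_poset_def by auto
  then have finCD: "finite C" "finite D"
    using fin finite_subset by blast+
  note iff = factor_poset_iff_scalar_form[of I ip f, OF fin ip nz]
  let ?q = "frame_form ip f"
  have sC: "scalar_form (?q C)" and sD: "scalar_form (?q D)"
    using C D iff sub by blast+
  note sCD = scalar_form_add[OF sC sD]
  \<comment> \<open>The factor \<open>1 *\<close> displays the shape \<open>p x - c * q x\<close> of
    \<open>scalar_form_diff_scale_iff\<close>, with \<open>p\<close> the sum of the forms of
    \<open>C\<close> and \<open>D\<close>.\<close>
  have "C \<union> D \<in> factor_poset ip f I \<longleftrightarrow> scalar_form (\<lambda>x. ?q C x + ?q D x - 1 * ?q (C \<inter> D) x)"
    using sub by (subst iff) (auto simp: ext[OF frame_form_Un[OF finCD]])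
  also have "\<dots> \<longleftrightarrow> C \<inter> D \<in> factor_poset ip f I"
    using sub scalar_form_diff_scale_iff[OF sCD, of 1] by (subst iff) auto
  finally show Un: "C \<union> D \<in> factor_poset ip f I \<longleftrightarrow> C \<inter> D \<in> factor_poset ip f I" .
  have "sym_diff C D \<in> factor_poset ip f I \<longleftrightarrow>
      scalar_form (\<lambda>x. ?q C x + ?q D x - 2 * ?q (C \<inter> D) x)"
    using sub by (subst iff) (auto simp: ext[OF frame_form_sym_diff[OF finCD]])
  also have "\<dots> \<longleftrightarrow> C \<inter> D \<in> factor_poset ip f I"
    using sub scalar_form_diff_scale_iff[OF sCD, of 2] by (subst iff) auto
  finally show sym: "C \<inter> D \<in> factor_poset ip f I \<longleftrightarrow> sym_diff C D \<in> factor_poset ip f I"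
    by blast
  have "C - D \<in> factor_poset ip f I \<longleftrightarrow> scalar_form (\<lambda>x. ?q C x - 1 * ?q (C \<inter> D) x)"
    using sub by (subst iff) (auto simp: ext[OF frame_form_diff[OF finCD(1)]])
  also have "\<dots> \<longleftrightarrow> C \<inter> D \<in> factor_poset ip f I"
    using sub scalar_form_diff_scale_iff[OF sC, of 1] by (subst iff) auto
  \<comment> \<open>\<open>C - D\<close> has been compared with \<open>C \<inter> D\<close>, which
    \<open>sym\<close> links to the symmetric difference.\<close>
  finally show "sym_diff C D \<in> factor_poset ip f I \<longleftrightarrow> C - D \<in> factor_poset ip f I"
    using sym by blast
qed

theorem proposition3p4:
  fixes k :: nat
  shows
    "(\<forall>f :: nat \<Rightarrow> real ^ 'n. \<forall>C D.
        (\<forall>i\<in>{1..k}. f i \<noteq> 0) \<longrightarrow> tight_frame inner f {1..k} \<longrightarrow>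
        C \<in> factor_poset inner f {1..k} \<longrightarrow> D \<in> factor_poset inner f {1..k} \<longrightarrow>
        (C \<union> D \<in> factor_poset inner f {1..k} \<longleftrightarrow> C \<inter> D \<in> factor_poset inner f {1..k}) \<and>
        (C \<inter> D \<in> factor_poset inner f {1..k} \<longleftrightarrow>
           sym_diff C D \<in> factor_poset inner f {1..k}) \<and>
        (sym_diff C D \<in> factor_poset inner f {1..k} \<longleftrightarrow>
           C - D \<in> factor_poset inner f {1..k})) \<and>
     (\<forall>f :: nat \<Rightarrow> complex ^ 'n. \<forall>C D.
        (\<forall>i\<in>{1..k}. f i \<noteq> 0) \<longrightarrow> tight_frame hermitian f {1..k} \<longrightarrow>
        C \<in> factor_poset hermitian f {1..k} \<longrightarrow> D \<in> factor_poset hermitian f {1..k} \<longrightarrow>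
        (C \<union> D \<in> factor_poset hermitian f {1..k} \<longleftrightarrow> C \<inter> D \<in> factor_poset hermitian f {1..k}) \<and>
        (C \<inter> D \<in> factor_poset hermitian f {1..k} \<longleftrightarrow>
           sym_diff C D \<in> factor_poset hermitian f {1..k}) \<and>
        (sym_diff C D \<in> factor_poset hermitian f {1..k} \<longleftrightarrow>
           C - D \<in> factor_poset hermitian f {1..k}))"
  \<comment> \<open>Both inner products satisfy the condition on \<open>ip v v\<close>; in the
    complex case \<open>hermitian_self\<close> turns it into the squared norm.\<close>
  by (intro conjI allI impI; rule factor_poset_Un_Int_sym_diff_Diff; simp add: hermitian_self)

end
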